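(* For every integer $d\geq 3$, $a_d(K_{d+1})=1$, where $K_{d+1}$ is the complete graph on $d+1$ vertices.
   Context: For a graph $G=(V,E)$ and a map $p:V\to\mathbb{R}^d$, for distinct $u,v\in V$ let $d_{uv}=\frac{p(u)-p(v)}{\|p(u)-p(v)\|}$ if $p(u)\neq p(v)$ and $d_{uv}=0$ otherwise. The normalized rigidity matrix $R(G,p)$ is the $d|V|\times|E|$ real matrix whose column indexed by the edge $\{u,v\}$ is $(1_u-1_v)\otimes d_{uv}$, where $\{1_u\}$ is the standard basis of $\mathbb{R}^{|V|}$ and $\otimes$ is the Kronecker product. The stiffness matrix is $L(G,p)=R(G,p)R(G,p)^t$. For a symmetric matrix $M$, $\lambda_i(M)$ denotes its $i$-th smallest eigenvalue. The $d$-dimensional algebraic connectivity of $G$ is $a_d(G)=\sup\{\lambda_{\binom{d+1}{2}+1}(L(G,p)) : p:V\to\mathbb{R}^d\}$. *)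

theory Defs
  imports "Jordan_Normal_Form.Char_Poly" "HOL-Library.Multiset"
begin

text \<open>A finite simple graph is a pair \<open>(n, E)\<close> with vertex set \<open>{0..<n}\<close> and a set \<open>E\<close> of edges,
  each a two-element subset of the vertex set.\<close>

type_synonym graph = "nat \<times> nat set set"

definition complete_graph :: "nat \<Rightarrow> graph" where
  "complete_graph n = (n, {{u, v} | u v. u < n \<and> v < n \<and> u \<noteq> v})"

text \<open>Each edge is listed exactly once, through its increasing pair of endpoints. Neither the order
  of the list nor the orientation of an edge matters for the matrix \<open>R R\<^sup>t\<close> below.\<close>

definition edge_list :: "graph \<Rightarrow> (nat \<times> nat) list" where
  "edge_list G = filter (\<lambda>(u, v). u < v \<and> {u, v} \<in> snd G) (List.product [0..<fst G] [0..<fst G])"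

definition eucl_norm :: "real vec \<Rightarrow> real" where
  "eucl_norm x = sqrt (x \<bullet> x)"

definition edge_dir :: "nat \<Rightarrow> (nat \<Rightarrow> real vec) \<Rightarrow> nat \<Rightarrow> nat \<Rightarrow> real vec" where
  "edge_dir d p u v =
     (if p u \<noteq> p v then (1 / eucl_norm (p u - p v)) \<cdot>\<^sub>v (p u - p v) else 0\<^sub>v d)"

definition kronecker_vec :: "real vec \<Rightarrow> real vec \<Rightarrow> real vec" where
  "kronecker_vec a b =
     vec (dim_vec a * dim_vec b) (\<lambda>i. a $ (i div dim_vec b) * b $ (i mod dim_vec b))"

definition rigidity_matrix :: "nat \<Rightarrow> graph \<Rightarrow> (nat \<Rightarrow> real vec) \<Rightarrow> real mat" where
  "rigidity_matrix d G p = mat_of_cols (d * fst G)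
     (map (\<lambda>(u, v). kronecker_vec (unit_vec (fst G) u - unit_vec (fst G) v) (edge_dir d p u v))
       (edge_list G))"

definition stiffness_matrix :: "nat \<Rightarrow> graph \<Rightarrow> (nat \<Rightarrow> real vec) \<Rightarrow> real mat" where
  "stiffness_matrix d G p = rigidity_matrix d G p * transpose_mat (rigidity_matrix d G p)"

text \<open>The \<open>i\<close>-th smallest eigenvalue, with \<open>i\<close> counted from 1 and eigenvalues repeated according to
  their algebraic multiplicity. Only meaningful for symmetric \<open>M\<close> (so that all complex roots of the
  characteristic polynomial are real) and \<open>i\<close> between 1 and the dimension of \<open>M\<close>.\<close>

definition nth_smallest_eigenvalue :: "nat \<Rightarrow> real mat \<Rightarrow> real" where
  "nth_smallest_eigenvalue i M = sorted_list_of_multiset (proots (char_poly M)) ! (i - 1)"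

text \<open>The set under the supremum is nonempty. If \<open>(d + 1) choose 2 < d * n\<close>, where \<open>n\<close> is the number
  of vertices, the index is in range; the set is then also bounded above, since the stiffness matrix
  is positive semidefinite with trace at most twice the number of edges. So the real-valued \<open>Sup\<close> is
  the genuine supremum.\<close>

definition algebraic_connectivity :: "nat \<Rightarrow> graph \<Rightarrow> real" where
  "algebraic_connectivity d G =
     Sup {nth_smallest_eigenvalue (((d + 1) choose 2) + 1) (stiffness_matrix d G p) | p.
            \<forall>v < fst G. p v \<in> carrier_vec d}"

end

theory Submission
  imports Defs
begin

text \<open>The \<open>d (d + 1)\<close>-dimensional matrix \<open>R R\<^sup>t\<close> has the eigenvalues of the Gram matrix \<open>R\<^sup>t R\<close>, which
  has size \<open>(d + 1) choose 2\<close>, together with \<open>(d + 1) choose 2\<close> zeros. So the eigenvalue in question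
  is the minimum of the Rayleigh quotient \<open>|R x|\<^sup>2 / |x|\<^sup>2\<close> over edge weights \<open>x\<close>.
  For a regular simplex, \<open>|R x|\<^sup>2\<close> is \<open>|x|\<^sup>2\<close> plus half the sum over the vertices of the squared weighted
  degrees. For arbitrary distinct points, take four of them and weight a four-cycle alternately by plus and minus
  its edge lengths: then \<open>|R x|\<^sup>2\<close> is twice the sum of the squared diagonals and \<open>|x|\<^sup>2\<close> the sum of
  the squared sides. Summed over the three four-cycles both quantities agree, so one of the
  four-cycles has Rayleigh quotient at most 1.\<close>

section \<open>Rayleigh quotients of real symmetric matrices\<close>

text \<open>Supplies the bound on the Rayleigh quotient and the bound on the form of an inverse
  matrix in the eigenvalue argument. The sum of the absolute values of the entries works because a
  product of two coordinates is at most \<open>x \<bullet> x\<close> in absolute value.\<close>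

lemma quadratic_form_bounded:
  fixes B :: "real mat"
  assumes B: "B \<in> carrier_mat m m"
  obtains C where "C > 0" "\<And>x. x \<in> carrier_vec m \<Longrightarrow> \<bar>x \<bullet> (B *\<^sub>v x)\<bar> \<le> C * (x \<bullet> x)"
proof
  define C where "C = (\<Sum>i<m. \<Sum>j<m. \<bar>B $$ (i, j)\<bar>)"
  have "C \<ge> 0" unfolding C_def by (intro sum_nonneg) auto
  \<comment> \<open>The shift by 1 keeps the constant positive even for the zero matrix; such a
    constant later serves as a denominator.\<close>
  then show "C + 1 > 0" by simp
  fix x :: "real vec" assume x: "x \<in> carrier_vec m"
  have sq: "x \<bullet> x = (\<Sum>i<m. (x $ i)\<^sup>2)"
    using x by (simp add: scalar_prod_def power2_eq_square atLeast0LessThan)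
  have le: "\<bar>x $ i * x $ j\<bar> \<le> x \<bullet> x" if "i < m" "j < m" for i j
  proof -
    have "(x $ i)\<^sup>2 \<le> x \<bullet> x" "(x $ j)\<^sup>2 \<le> x \<bullet> x"
      unfolding sq using that by (auto intro!: member_le_sum)
    moreover have "2 * \<bar>x $ i * x $ j\<bar> \<le> (x $ i)\<^sup>2 + (x $ j)\<^sup>2"
      using sum_squares_bound[of "\<bar>x $ i\<bar>" "\<bar>x $ j\<bar>"] by (simp add: abs_mult)
    ultimately show ?thesis by linarith
  qed
  have "\<bar>x \<bullet> (B *\<^sub>v x)\<bar> = \<bar>\<Sum>i<m. \<Sum>j<m. B $$ (i, j) * (x $ i * x $ j)\<bar>"
    using x B by (simp add: scalar_prod_def atLeast0LessThan sum_distrib_left mult_ac)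
  also have "\<dots> \<le> (\<Sum>i<m. \<Sum>j<m. \<bar>B $$ (i, j)\<bar> * \<bar>x $ i * x $ j\<bar>)"
    by (intro order.trans[OF sum_abs] sum_mono order.trans[OF sum_abs]) (simp add: abs_mult)
  also have "\<dots> \<le> (\<Sum>i<m. \<Sum>j<m. \<bar>B $$ (i, j)\<bar> * (x \<bullet> x))"
    by (intro sum_mono mult_left_mono le) auto
  also have "\<dots> = C * (x \<bullet> x)" by (simp add: C_def sum_distrib_right)
  also have "\<dots> \<le> (C + 1) * (x \<bullet> x)"
    unfolding sq by (intro mult_right_mono sum_nonneg) auto
  finally show "\<bar>x \<bullet> (B *\<^sub>v x)\<bar> \<le> (C + 1) * (x \<bullet> x)" .
qed

lemma scalar_prod_self_pos:
  fixes x :: "real vec"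
  assumes "x \<in> carrier_vec m" "x \<noteq> 0\<^sub>v m"
  shows "x \<bullet> x > 0"
proof -
  from assms obtain i where i: "i < m" "x $ i \<noteq> 0" by (auto simp: vec_eq_iff)
  have "x \<bullet> x = (\<Sum>i<m. (x $ i)\<^sup>2)"
    using assms by (simp add: scalar_prod_def power2_eq_square atLeast0LessThan)
  also have "\<dots> > 0" using i by (intro sum_pos2[of _ i]) auto
  finally show ?thesis .
qed

lemma symmetric_mat_scalar_prod:
  fixes A :: "real mat"
  assumes "A \<in> carrier_mat m m" "A\<^sup>T = A" "x \<in> carrier_vec m" "y \<in> carrier_vec m"
  shows "x \<bullet> (A *\<^sub>v y) = y \<bullet> (A *\<^sub>v x)"
  using transpose_vec_mult_scalar[OF assms(1,4,3)] assms
  by (simp add: comm_scalar_prod[of _ m])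

text \<open>The form at a combination of \<open>x\<close> and \<open>y\<close> is a nonnegative
  quadratic in the two coefficients; suitable coefficients yield the discriminant inequality.
  Definiteness is not assumed, so the form may vanish at \<open>x\<close>, which is a separate
  case.\<close>

lemma psd_cauchy_schwarz:
  fixes A :: "real mat"
  assumes A: "A \<in> carrier_mat m m" and sym: "A\<^sup>T = A"
    and psd: "\<And>x. x \<in> carrier_vec m \<Longrightarrow> x \<bullet> (A *\<^sub>v x) \<ge> 0"
    and x: "x \<in> carrier_vec m" and y: "y \<in> carrier_vec m"
  shows "(x \<bullet> (A *\<^sub>v y))\<^sup>2 \<le> (x \<bullet> (A *\<^sub>v x)) * (y \<bullet> (A *\<^sub>v y))"
proof -
  let ?a = "x \<bullet> (A *\<^sub>v x)" and ?b = "x \<bullet> (A *\<^sub>v y)" and ?c = "y \<bullet> (A *\<^sub>v y)"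
  have q: "s\<^sup>2 * ?a + 2 * s * t * ?b + t\<^sup>2 * ?c \<ge> 0" for s t
  proof -
    let ?z = "s \<cdot>\<^sub>v x + t \<cdot>\<^sub>v y"
    have Az: "A *\<^sub>v ?z = s \<cdot>\<^sub>v (A *\<^sub>v x) + t \<cdot>\<^sub>v (A *\<^sub>v y)"
      using A x y by (simp add: mult_add_distrib_mat_vec mult_mat_vec)
    have c: "A *\<^sub>v x \<in> carrier_vec m" "A *\<^sub>v y \<in> carrier_vec m" using A x y by auto
    have "?z \<bullet> (A *\<^sub>v ?z) = s\<^sup>2 * ?a + s * t * ?b + t * s * (y \<bullet> (A *\<^sub>v x)) + t\<^sup>2 * ?c"
      unfolding Az using c x y
      by (simp add: scalar_prod_add_distrib[of _ m] add_scalar_prod_distrib[of _ m]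
          power2_eq_square algebra_simps)
    moreover have "?z \<bullet> (A *\<^sub>v ?z) \<ge> 0" using x y by (intro psd) auto
    ultimately show ?thesis using symmetric_mat_scalar_prod[OF A sym x y] by (simp add: algebra_simps)
  qed
  have ac: "?a \<ge> 0" "?c \<ge> 0" using psd x y by auto
  show ?thesis
  proof (cases "?a = 0")
    case True
    have "?b = 0"
    proof (rule ccontr)
      assume "?b \<noteq> 0"
      \<comment> \<open>With \<open>?a = 0\<close> the quadratic is linear in \<open>s\<close>; this
        \<open>s\<close>, together with \<open>t = 1\<close>, makes it equal to -1.\<close>
      then show False using q[of "- (?c + 1) / (2 * ?b)" 1] True by (simp add: field_simps)
    qed
    then show ?thesis using ac by simp
  next
    case False
    then have "?a > 0" using ac by simp
    \<comment> \<open>With \<open>s = - ?b\<close> and \<open>t = ?a\<close> the quadratic becomes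
      \<open>?a\<close> times the discriminant \<open>?a * ?c - ?b\<^sup>2\<close>.\<close>
    have "?b\<^sup>2 * ?a + 2 * (-?b) * ?a * ?b + ?a\<^sup>2 * ?c \<ge> 0" using q[of "-?b" ?a] by simp
    then have "?a * (?a * ?c - ?b\<^sup>2) \<ge> 0" by (simp add: power2_eq_square algebra_simps)
    then show ?thesis using \<open>?a > 0\<close> by (simp add: zero_le_mult_iff)
  qed
qed

text \<open>The infimum \<open>\<mu>\<close> of the Rayleigh quotient is an eigenvalue: if \<open>A = G - \<mu> I\<close> had an inverse \<open>B\<close>,
  the Cauchy-Schwarz inequality for the form \<open>A\<close> at \<open>y\<close> and \<open>B y\<close> would give
  \<open>|y|\<^sup>4 \<le> (y \<bullet> A y) (y \<bullet> B y)\<close>, so \<open>A\<close> would be coercive.\<close>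

lemma symmetric_mat_eigenvalue_le:
  fixes G :: "real mat"
  assumes G: "G \<in> carrier_mat m m" and sym: "G\<^sup>T = G"
    and x: "x \<in> carrier_vec m" "x \<noteq> 0\<^sub>v m" and le: "x \<bullet> (G *\<^sub>v x) \<le> c * (x \<bullet> x)"
  obtains k where "k \<le> c" "eigenvalue G k"
proof
  define S where "S = {(y \<bullet> (G *\<^sub>v y)) / (y \<bullet> y) | y. y \<in> carrier_vec m \<and> y \<noteq> 0\<^sub>v m}"
  define \<mu> where "\<mu> = Inf S"
  obtain C where "C > 0" and C: "\<And>x. x \<in> carrier_vec m \<Longrightarrow> \<bar>x \<bullet> (G *\<^sub>v x)\<bar> \<le> C * (x \<bullet> x)"
    using quadratic_form_bounded[OF G] by blast
  have bdd: "bdd_below S"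
  proof (rule bdd_belowI)
    fix r assume "r \<in> S"
    then obtain y where y: "y \<in> carrier_vec m" "y \<noteq> 0\<^sub>v m" "r = (y \<bullet> (G *\<^sub>v y)) / (y \<bullet> y)"
      unfolding S_def by auto
    have "- C * (y \<bullet> y) \<le> y \<bullet> (G *\<^sub>v y)" using C[OF y(1)] by linarith
    then show "- C \<le> r"
      using scalar_prod_self_pos[OF y(1,2)] y(3) by (simp add: pos_le_divide_eq)
  qed
  have ne: "S \<noteq> {}" using x unfolding S_def by blast
  have "\<mu> \<le> (x \<bullet> (G *\<^sub>v x)) / (x \<bullet> x)"
    unfolding \<mu>_def using x by (intro cInf_lower bdd) (auto simp: S_def)
  also have "\<dots> \<le> c" using le scalar_prod_self_pos[OF x] by (simp add: field_simps)
  finally show "\<mu> \<le> c" .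
  define A where "A = char_matrix G \<mu>"
  have A: "A \<in> carrier_mat m m" unfolding A_def using G by simp
  have symA: "A\<^sup>T = A"
    unfolding A_def char_matrix_def using G sym
    by (intro eq_matI) (auto simp: mat_eq_iff)
  have Ay: "y \<bullet> (A *\<^sub>v y) = y \<bullet> (G *\<^sub>v y) - \<mu> * (y \<bullet> y)" if "y \<in> carrier_vec m" for y
  proof -
    have "(- \<mu>) \<cdot>\<^sub>m 1\<^sub>m m *\<^sub>v y = (- \<mu>) \<cdot>\<^sub>v y"
      using that by (intro eq_vecI) auto
    then show ?thesis unfolding A_def char_matrix_def using G that
      by (simp add: add_mult_distrib_mat_vec[of _ m m] scalar_prod_add_distrib[of _ m])
  qed
  have psd: "y \<bullet> (A *\<^sub>v y) \<ge> 0" if y: "y \<in> carrier_vec m" for y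
  proof (cases "y = 0\<^sub>v m")
    case False
    have "\<mu> \<le> (y \<bullet> (G *\<^sub>v y)) / (y \<bullet> y)"
      unfolding \<mu>_def using y False by (intro cInf_lower bdd) (auto simp: S_def)
    then show ?thesis using Ay[OF y] scalar_prod_self_pos[OF y False] by (simp add: field_simps)
  qed (use A in simp)
  have "det A = 0"
  proof (rule ccontr)
    assume "det A \<noteq> 0"
    from det_non_zero_imp_unit[OF A this, of "()"]
    obtain B where B: "B \<in> carrier_mat m m" and AB: "A * B = 1\<^sub>m m"
      unfolding Units_def by (auto simp: ring_mat_simps)
    obtain D where "D > 0" and D: "\<And>x. x \<in> carrier_vec m \<Longrightarrow> \<bar>x \<bullet> (B *\<^sub>v x)\<bar> \<le> D * (x \<bullet> x)"
      using quadratic_form_bounded[OF B] by blast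
    have coercive: "(y \<bullet> y) / D \<le> y \<bullet> (A *\<^sub>v y)"
      if y: "y \<in> carrier_vec m" "y \<noteq> 0\<^sub>v m" for y
    proof -
      have By: "B *\<^sub>v y \<in> carrier_vec m" using B y by simp
      have ABy: "A *\<^sub>v (B *\<^sub>v y) = y"
        using assoc_mult_mat_vec[OF A B y(1)] AB y by simp
      have pos: "y \<bullet> y > 0" by (rule scalar_prod_self_pos[OF y])
      have "(y \<bullet> y)\<^sup>2 \<le> (y \<bullet> (A *\<^sub>v y)) * ((B *\<^sub>v y) \<bullet> y)"
        using psd_cauchy_schwarz[OF A symA psd y(1) By] ABy by simp
      also have "\<dots> \<le> (y \<bullet> (A *\<^sub>v y)) * (D * (y \<bullet> y))"
        using D[OF y(1)] comm_scalar_prod[OF y(1) By]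
        by (intro mult_left_mono psd y) linarith
      finally have "(y \<bullet> y) * (y \<bullet> y) \<le> (y \<bullet> (A *\<^sub>v y) * D) * (y \<bullet> y)"
        by (simp add: power2_eq_square mult_ac)
      then have "y \<bullet> y \<le> y \<bullet> (A *\<^sub>v y) * D" using pos by simp
      then show ?thesis using \<open>D > 0\<close> by (simp add: field_simps)
    qed
    \<comment> \<open>Coercivity lifts every Rayleigh quotient to at least
      \<open>\<mu> + 1 / D\<close>, so the infimum would exceed itself.\<close>
    have "\<mu> + 1 / D \<le> \<mu>"
      unfolding \<mu>_def
    proof (rule cInf_greatest[OF ne], fold \<mu>_def)
      fix r assume "r \<in> S"
      then obtain y where y: "y \<in> carrier_vec m" "y \<noteq> 0\<^sub>v m" "r = (y \<bullet> (G *\<^sub>v y)) / (y \<bullet> y)"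
        unfolding S_def by auto
      have "(\<mu> + 1 / D) * (y \<bullet> y) \<le> y \<bullet> (G *\<^sub>v y)"
        using coercive[OF y(1,2)] Ay[OF y(1)] by (simp add: algebra_simps)
      then show "\<mu> + 1 / D \<le> r"
        using scalar_prod_self_pos[OF y(1,2)] y(3) by (simp add: pos_le_divide_eq)
    qed
    then show False using \<open>D > 0\<close> by simp
  qed
  then show "eigenvalue G \<mu>" using eigenvalue_det[OF G] unfolding A_def by simp
qed

section \<open>Spectra of A B and B A, and the Gram matrix\<close>

text \<open>Sylvester's determinant identity: multiplying one block matrix \<open>X\<close> from the
  right and from the left by block triangular matrices exposes the two characteristic polynomials.
  Powers of the variable stand on both sides, so either size may be the larger one.\<close>

lemma char_poly_mult_commute:
  fixes A B :: "'a :: idom mat"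
  assumes A: "A \<in> carrier_mat n m" and B: "B \<in> carrier_mat m n"
  shows "[:0, 1:] ^ m * char_poly (A * B) = [:0, 1:] ^ n * char_poly (B * A)"
proof -
  let ?t = "[:0, 1:] :: 'a poly"
  interpret c: comm_ring_hom "\<lambda>a :: 'a. [:a:]" by unfold_locales (auto simp: one_pCons)
  define A' where "A' = map_mat (\<lambda>a. [:a:]) A"
  define B' where "B' = map_mat (\<lambda>a. [:a:]) B"
  have A': "A' \<in> carrier_mat n m" and B': "B' \<in> carrier_mat m n"
    using A B by (auto simp: A'_def B'_def)
  have cp: "char_poly_matrix M = ?t \<cdot>\<^sub>m 1\<^sub>m k - map_mat (\<lambda>a. [:a:]) M" if "M \<in> carrier_mat k k"
    for M :: "'a mat" and k
    unfolding char_poly_matrix_def using that by (intro eq_matI) auto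
  have cAB: "char_poly_matrix (A * B) = ?t \<cdot>\<^sub>m 1\<^sub>m n - A' * B'"
    and cBA: "char_poly_matrix (B * A) = ?t \<cdot>\<^sub>m 1\<^sub>m m - B' * A'"
    using cp[of "A * B" n] cp[of "B * A" m] A B c.mat_hom_mult[OF A B] c.mat_hom_mult[OF B A]
    by (auto simp: A'_def B'_def)
  define X where "X = four_block_mat (?t \<cdot>\<^sub>m 1\<^sub>m n) A' B' (1\<^sub>m m)"
  have X: "X \<in> carrier_mat (n + m) (n + m)" unfolding X_def using A' B' by simp
  let ?L = "four_block_mat (1\<^sub>m n) (0\<^sub>m n m) (- B') (1\<^sub>m m)"
  let ?L' = "four_block_mat (1\<^sub>m n) (0\<^sub>m n m) (- B') (?t \<cdot>\<^sub>m 1\<^sub>m m)"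
  \<comment> \<open>A column operation of determinant 1 clears the lower left block and leaves the
    Schur complement in the upper left one.\<close>
  have "X * ?L = four_block_mat (?t \<cdot>\<^sub>m 1\<^sub>m n - A' * B') A' (0\<^sub>m m n) (1\<^sub>m m)"
    unfolding X_def using A' B'
    by (subst mult_four_block_mat[of _ n n _ m _ m _ _ n _ m]) (auto intro!: cong_four_block_mat)
  then have "det (X * ?L) = char_poly (A * B)"
    unfolding char_poly_def cAB using A' B'
    by (simp, subst det_four_block_mat_lower_left_zero[of _ n _ m]) auto
  moreover have "det (X * ?L) = det X"
    using A' B' X by (subst det_mult[of _ "n + m"]) (auto simp: det_four_block_mat_upper_right_zero[of _ n _ m])
  ultimately have det_X: "det X = char_poly (A * B)" by simp
  have 1: "(- B') * (?t \<cdot>\<^sub>m 1\<^sub>m n) + ?t \<cdot>\<^sub>m 1\<^sub>m m * B' = 0\<^sub>m m n"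
    using B' by (intro eq_matI) (auto simp: mult_smult_distrib[of _ m n _ n] mult_smult_assoc_mat[of _ m m _ n])
  \<comment> \<open>The lower right block of \<open>?L'\<close> is scaled by \<open>?t\<close> so
    that the lower left block of the product cancels; the price is the determinant factor
    \<open>?t ^ m\<close>.\<close>
  have "?L' * X = four_block_mat (?t \<cdot>\<^sub>m 1\<^sub>m n) A' (0\<^sub>m m n) (?t \<cdot>\<^sub>m 1\<^sub>m m - B' * A')"
    unfolding X_def using A' B' 1
    by (subst mult_four_block_mat[of _ n n _ m _ m _ _ n _ m]) (auto intro!: cong_four_block_mat)
  then have "det (?L' * X) = det (?t \<cdot>\<^sub>m 1\<^sub>m n) * char_poly (B * A)"
    unfolding char_poly_def cBA using A' B'
    by (simp, subst det_four_block_mat_lower_left_zero[of _ n _ m]) auto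
  moreover have "det (?L' * X) = det (?t \<cdot>\<^sub>m 1\<^sub>m m) * det X"
    using A' B' X by (subst det_mult[of _ "n + m"]) (auto simp: det_four_block_mat_upper_right_zero[of _ n _ m])
  ultimately show ?thesis using det_X by (simp add: det_smult)
qed

text \<open>\<open>R * R\<^sup>T\<close> has the roots of the Gram matrix and \<open>k\<close>
  further zeros. Gram eigenvalues are nonnegative, so in sorted order these zeros come first and the
  smallest Gram eigenvalue follows.\<close>

lemma nth_smallest_eigenvalue_gram:
  fixes R :: "real mat"
  assumes R: "R \<in> carrier_mat (k + m) m" and m: "m > 0"
  shows "finite {e. eigenvalue (R\<^sup>T * R) e}" (is "finite ?S")
    and "{e. eigenvalue (R\<^sup>T * R) e} \<noteq> {}"
    and "nth_smallest_eigenvalue (Suc k) (R * R\<^sup>T) = Min {e. eigenvalue (R\<^sup>T * R) e}"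
proof -
  let ?G = "R\<^sup>T * R"
  have G: "?G \<in> carrier_mat m m" using R by auto
  have "[:0, 1:] ^ m * char_poly (R * R\<^sup>T) = [:0, 1:] ^ m * ([:0, 1:] ^ k * char_poly ?G)"
    using char_poly_mult_commute[of R "k + m" m "R\<^sup>T"] R by (simp add: power_add mult_ac)
  then have cp: "char_poly (R * R\<^sup>T) = [:0, 1:] ^ k * char_poly ?G" by simp
  have nz: "char_poly ?G \<noteq> 0" using degree_monic_char_poly[OF G] by auto
  have set: "set_mset (proots (char_poly ?G)) = ?S"
    using eigenvalue_root_char_poly[OF G] nz by auto
  then show fin: "finite ?S" by (metis finite_set_mset)
  have nonneg: "e \<ge> 0" if "e \<in> ?S" for e
  proof -
    from that obtain v where v: "v \<in> carrier_vec m" "v \<noteq> 0\<^sub>v m" "?G *\<^sub>v v = e \<cdot>\<^sub>v v"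
      using R unfolding eigenvalue_def eigenvector_def by auto
    have Rv: "R *\<^sub>v v \<in> carrier_vec (k + m)" by (rule mult_mat_vec_carrier[OF R v(1)])
    have "e * (v \<bullet> v) = (R *\<^sub>v v) \<bullet> (R *\<^sub>v v)"
      using transpose_vec_mult_scalar[OF R v(1) Rv] v R by (simp add: assoc_mult_mat_vec[of _ m "k + m" _ m])
    also have "\<dots> \<ge> 0" by (simp add: scalar_prod_def sum_nonneg)
    finally show ?thesis using scalar_prod_self_pos[OF v(1,2)] by (simp add: zero_le_mult_iff)
  qed
  show ne: "?S \<noteq> {}"
  proof -
    \<comment> \<open>A real eigenvalue exists because any upper bound on the Rayleigh quotient at a
      single nonzero vector produces one.\<close>
    obtain C where "\<And>x. x \<in> carrier_vec m \<Longrightarrow> \<bar>x \<bullet> (?G *\<^sub>v x)\<bar> \<le> C * (x \<bullet> x)"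
      using quadratic_form_bounded[OF G] by blast
    from this[of "unit_vec m 0"] have "unit_vec m 0 \<bullet> (?G *\<^sub>v unit_vec m 0) \<le> C * (unit_vec m 0 \<bullet> unit_vec m 0)"
      by simp
    then show ?thesis
      using symmetric_mat_eigenvalue_le[OF G, of "unit_vec m 0" C] R m
      by (auto simp: transpose_mult[of _ m "k + m" _ m])
  qed
  define xs where "xs = sorted_list_of_multiset (proots (char_poly ?G))"
  have xs: "set xs = ?S" "sorted xs" using set by (auto simp: xs_def)
  then have "xs \<noteq> []" using ne by auto
  have "proots (char_poly (R * R\<^sup>T)) = mset (replicate k 0 @ xs)"
    unfolding cp using nz by (simp add: proots_mult proots_power xs_def repeat_mset_replicate_mset)
  then have "sorted_list_of_multiset (proots (char_poly (R * R\<^sup>T))) = sort (replicate k 0 @ xs)"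
    by (simp only: sorted_list_of_multiset_mset)
  also have "\<dots> = replicate k 0 @ xs"
    using xs nonneg by (intro sorted_sort_id) (auto simp: sorted_append)
  \<comment> \<open>Position \<open>Suc k\<close> counted from 1 is list index \<open>k\<close>, the
    first one behind the zeros.\<close>
  finally have "nth_smallest_eigenvalue (Suc k) (R * R\<^sup>T) = hd xs"
    using \<open>xs \<noteq> []\<close> unfolding nth_smallest_eigenvalue_def by (simp add: nth_append hd_conv_nth)
  also have "\<dots> = Min ?S"
  proof (rule Min_eqI[symmetric])
    show "hd xs \<le> e" if "e \<in> ?S" for e
      using that sorted_nth_mono[OF xs(2), of 0] \<open>xs \<noteq> []\<close>
      by (auto simp flip: xs(1) simp: in_set_conv_nth hd_conv_nth)
  qed (use fin xs \<open>xs \<noteq> []\<close> in auto)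
  finally show "nth_smallest_eigenvalue (Suc k) (R * R\<^sup>T) = Min ?S" .
qed

text \<open>A single test vector suffices: the Rayleigh quotient of \<open>R\<^sup>T * R\<close> at
  \<open>x\<close> is the quotient of the squared lengths of \<open>R *\<^sub>v x\<close> and
  \<open>x\<close>, and some eigenvalue lies at or below it.\<close>

lemma nth_smallest_eigenvalue_gram_le:
  fixes R :: "real mat"
  assumes R: "R \<in> carrier_mat (k + m) m"
    and x: "x \<in> carrier_vec m" "x \<noteq> 0\<^sub>v m" and le: "(R *\<^sub>v x) \<bullet> (R *\<^sub>v x) \<le> c * (x \<bullet> x)"
  shows "nth_smallest_eigenvalue (Suc k) (R * R\<^sup>T) \<le> c"
proof -
  have m: "m > 0" using x by (cases m) auto
  have Rx: "R *\<^sub>v x \<in> carrier_vec (k + m)" by (rule mult_mat_vec_carrier[OF R x(1)])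
  have "x \<bullet> (R\<^sup>T * R *\<^sub>v x) = (R *\<^sub>v x) \<bullet> (R *\<^sub>v x)"
    using transpose_vec_mult_scalar[OF R x(1) Rx] x R
    by (simp add: assoc_mult_mat_vec[of _ m "k + m" _ m] comm_scalar_prod[of _ m])
  then obtain e where "e \<le> c" "eigenvalue (R\<^sup>T * R) e"
    using symmetric_mat_eigenvalue_le[of "R\<^sup>T * R" m x c] R x le
    by (auto simp: transpose_mult[of _ m "k + m" _ m])
  then show ?thesis
    using nth_smallest_eigenvalue_gram[OF R m] by (auto simp: Min_le_iff)
qed

text \<open>At an eigenvector of \<open>R\<^sup>T * R\<close> the quotient of squared lengths is the
  eigenvalue itself, so a uniform bound passes to every eigenvalue.\<close>

lemma nth_smallest_eigenvalue_gram_ge: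
  fixes R :: "real mat"
  assumes R: "R \<in> carrier_mat (k + m) m" and m: "m > 0"
    and ge: "\<And>x. x \<in> carrier_vec m \<Longrightarrow> c * (x \<bullet> x) \<le> (R *\<^sub>v x) \<bullet> (R *\<^sub>v x)"
  shows "c \<le> nth_smallest_eigenvalue (Suc k) (R * R\<^sup>T)"
proof -
  have "c \<le> e" if "eigenvalue (R\<^sup>T * R) e" for e
  proof -
    from that obtain v where v: "v \<in> carrier_vec m" "v \<noteq> 0\<^sub>v m" "R\<^sup>T * R *\<^sub>v v = e \<cdot>\<^sub>v v"
      using R unfolding eigenvalue_def eigenvector_def by auto
    have Rv: "R *\<^sub>v v \<in> carrier_vec (k + m)" by (rule mult_mat_vec_carrier[OF R v(1)])
    have "e * (v \<bullet> v) = (R *\<^sub>v v) \<bullet> (R *\<^sub>v v)"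
      using transpose_vec_mult_scalar[OF R v(1) Rv] v R by (simp add: assoc_mult_mat_vec[of _ m "k + m" _ m])
    then have "c * (v \<bullet> v) \<le> e * (v \<bullet> v)" using ge[OF v(1)] by simp
    then show ?thesis using scalar_prod_self_pos[OF v(1,2)] by simp
  qed
  then show ?thesis using nth_smallest_eigenvalue_gram[OF R m] by simp
qed

section \<open>Sums over the edges of the complete graph\<close>

definition increasing_pairs :: "nat \<Rightarrow> (nat \<times> nat) set" where
  "increasing_pairs n = {(u, v). u < v \<and> v < n}"

text \<open>The ordered pairs of distinct vertices are the increasing pairs together with their
  mirror images. This turns sums over edges into sums grouped by vertex.\<close>

lemma sum_increasing_pairs:
  fixes f :: "nat \<Rightarrow> nat \<Rightarrow> 'a::comm_monoid_add"
  shows "(\<Sum>(u, v)\<in>increasing_pairs n. f u v + f v u) = (\<Sum>u<n. \<Sum>v\<in>{..<n} - {u}. f u v)"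
proof -
  let ?E = "increasing_pairs n"
  have fin: "finite ?E"
    by (rule finite_subset[of _ "{..<n} \<times> {..<n}"]) (auto simp: increasing_pairs_def)
  have un: "(SIGMA u:{..<n}. {..<n} - {u}) = ?E \<union> prod.swap ` ?E"
    by (force simp: increasing_pairs_def image_iff)
  have "(\<Sum>u<n. \<Sum>v\<in>{..<n} - {u}. f u v) = (\<Sum>(u, v)\<in>?E \<union> prod.swap ` ?E. f u v)"
    by (subst sum.Sigma) (auto simp: un)
  also have "\<dots> = (\<Sum>(u, v)\<in>?E. f u v) + (\<Sum>(u, v)\<in>prod.swap ` ?E. f u v)"
    using fin by (intro sum.union_disjoint) (auto simp: increasing_pairs_def)
  also have "(\<Sum>(u, v)\<in>prod.swap ` ?E. f u v) = (\<Sum>(u, v)\<in>?E. f v u)"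
    by (subst sum.reindex) (auto simp: case_prod_beta)
  finally show ?thesis by (simp add: sum.distrib case_prod_beta)
qed

abbreviation complete_edges :: "nat \<Rightarrow> (nat \<times> nat) list" where
  "complete_edges n \<equiv> edge_list (complete_graph n)"

lemma fst_complete_graph [simp]: "fst (complete_graph n) = n"
  by (simp add: complete_graph_def)

lemma set_complete_edges: "set (complete_edges n) = increasing_pairs n"
proof -
  have "{u, v} \<in> snd (complete_graph n)" if "u < n" "v < n" "u \<noteq> v" for u v
    using that unfolding complete_graph_def snd_conv by blast
  then show ?thesis by (auto simp: edge_list_def increasing_pairs_def)
qed

lemma distinct_complete_edges: "distinct (complete_edges n)"
  by (simp add: edge_list_def distinct_product)

lemma sum_complete_edges:
  "(\<Sum>i<length (complete_edges n). f (complete_edges n ! i)) = sum f (increasing_pairs n)"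
  unfolding set_complete_edges[symmetric]
  by (rule sum.reindex_bij_betw) (rule bij_betw_nth[OF distinct_complete_edges], auto)

lemma length_complete_edges: "2 * length (complete_edges n) = n * (n - 1)"
proof -
  have "2 * length (complete_edges n) = (\<Sum>(u, v)\<in>increasing_pairs n. 1 + 1)"
    using sum_complete_edges[of "\<lambda>_. 2 :: nat" n] by (simp add: case_prod_beta)
  also have "\<dots> = n * (n - 1)"
    unfolding sum_increasing_pairs by simp
  finally show ?thesis .
qed

text \<open>Edge weights are carried as functions of two vertices, so that symmetric weights can be
  summed around each vertex; only the values at increasing pairs enter.\<close>

definition edge_vec :: "nat \<Rightarrow> (nat \<Rightarrow> nat \<Rightarrow> real) \<Rightarrow> real vec" where
  "edge_vec n y = vec (length (complete_edges n)) (\<lambda>i. case complete_edges n ! i of (u, v) \<Rightarrow> y u v)"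

lemma edge_vec_carrier: "edge_vec n y \<in> carrier_vec (length (complete_edges n))"
  by (simp add: edge_vec_def)

lemma edge_vec_exhaust:
  assumes x: "x \<in> carrier_vec (length (complete_edges n))"
  obtains y where "\<And>u v. y u v = y v u" "x = edge_vec n y"
proof
  \<comment> \<open>\<open>min\<close> and \<open>max\<close> make the weight symmetric. Off the
    edges the description has no witness and the value is arbitrary, but \<open>edge_vec\<close>
    never reads it.\<close>
  define y where "y u v = x $ (THE i. i < length (complete_edges n) \<and> complete_edges n ! i = (min u v, max u v))"
    for u v
  show "y u v = y v u" for u v by (simp add: y_def min.commute max.commute)
  show "x = edge_vec n y"
  proof (rule eq_vecI)
    fix i assume "i < dim_vec (edge_vec n y)"
    then have i: "i < length (complete_edges n)" by (simp add: edge_vec_def)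
    obtain u v where uv: "complete_edges n ! i = (u, v)" by fastforce
    then have "u < v" using nth_mem[OF i] unfolding set_complete_edges by (auto simp: increasing_pairs_def)
    then have "(THE k. k < length (complete_edges n) \<and> complete_edges n ! k = (min u v, max u v)) = i"
      using i uv nth_eq_iff_index_eq[OF distinct_complete_edges, of _ n i]
      by (intro the_equality) auto
    then show "x $ i = edge_vec n y $ i" using i uv by (simp add: edge_vec_def y_def)
  qed (use x in \<open>simp add: edge_vec_def\<close>)
qed

lemma edge_vec_norm:
  assumes sym: "\<And>u v. y u v = y v u"
  shows "edge_vec n y \<bullet> edge_vec n y = (\<Sum>u<n. \<Sum>v\<in>{..<n} - {u}. (y u v)\<^sup>2) / 2"
proof -
  have "edge_vec n y \<bullet> edge_vec n y = (\<Sum>(u, v)\<in>increasing_pairs n. (y u v)\<^sup>2)"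
    unfolding sum_complete_edges[symmetric]
    by (auto simp: scalar_prod_def edge_vec_def atLeast0LessThan case_prod_beta power2_eq_square intro!: sum.cong)
  \<comment> \<open>Each square is shared equally between the two orientations, which is the shape
    that \<open>sum_increasing_pairs\<close> expects.\<close>
  also have "\<dots> = (\<Sum>(u, v)\<in>increasing_pairs n. (y u v)\<^sup>2 / 2 + (y v u)\<^sup>2 / 2)"
    by (intro sum.cong refl) (simp add: sym case_prod_beta)
  finally show ?thesis
    unfolding sum_increasing_pairs by (simp add: sum_divide_distrib)
qed

section \<open>The rigidity matrix applied to edge weights\<close>

text \<open>Coincident points fit the same formula: the numerator is then 0, in agreement with the
  zero direction.\<close>

lemma edge_dir_index:
  assumes "p u \<in> carrier_vec d" "p v \<in> carrier_vec d" "j < d"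
  shows "edge_dir d p u v $ j = (p u $ j - p v $ j) / eucl_norm (p u - p v)"
  using assms by (auto simp: edge_dir_def)

lemma eucl_norm_minus_commute:
  assumes "a \<in> carrier_vec d" "b \<in> carrier_vec d"
  shows "eucl_norm (a - b) = eucl_norm (b - a)"
  using assms unfolding eucl_norm_def scalar_prod_def
  by (auto intro!: arg_cong[of _ _ sqrt] sum.cong simp: algebra_simps)

lemma edge_dir_swap:
  assumes "p u \<in> carrier_vec d" "p v \<in> carrier_vec d" "j < d"
  shows "edge_dir d p v u $ j = - edge_dir d p u v $ j"
  using assms eucl_norm_minus_commute[OF assms(1,2)]
  by (simp add: edge_dir_index minus_divide_left del: minus_divide_left[symmetric])

lemma rigidity_matrix_carrier:
  "rigidity_matrix d (complete_graph n) p \<in> carrier_mat (d * n) (length (complete_edges n))"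
  by (intro carrier_matI) (simp_all add: rigidity_matrix_def)

text \<open>In the Kronecker order, row \<open>u * d + j\<close> is component \<open>j\<close> at
  vertex \<open>u\<close>. An edge adds its direction at one endpoint and the negative at the other,
  which is the direction seen from there, so the orientation drops out. Read as forces along the
  edges, the weights yield the resultant at \<open>u\<close>.\<close>

lemma rigidity_matrix_mult_edge_vec:
  assumes p: "\<And>v. v < n \<Longrightarrow> p v \<in> carrier_vec d" and sym: "\<And>u v. y u v = y v u"
    and u: "u < n" and j: "j < d"
  shows "(rigidity_matrix d (complete_graph n) p *\<^sub>v edge_vec n y) $ (u * d + j) =
    (\<Sum>v\<in>{..<n} - {u}. y u v * edge_dir d p u v $ j)"
proof -
  let ?R = "rigidity_matrix d (complete_graph n) p" and ?es = "complete_edges n"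
  have k: "u * d + j < d * n"
  proof -
    have "u * d + j < (u + 1) * d" using j by simp
    also have "\<dots> \<le> n * d" using u by (intro mult_right_mono) auto
    finally show ?thesis by (simp add: mult.commute)
  qed
  \<comment> \<open>The contribution of the ordered pair \<open>(a, b)\<close> to the row of
    \<open>u\<close>; an edge contributes through both of its orientations, at most one of which
    starts at \<open>u\<close>.\<close>
  define g where "g a b = (if a = u then y a b * edge_dir d p a b $ j else 0)" for a b
  have entry: "?R $$ (u * d + j, i) * edge_vec n y $ i = (case ?es ! i of (a, b) \<Rightarrow> g a b + g b a)"
    if i: "i < length ?es" for i
  proof -
    obtain a b where ab: "?es ! i = (a, b)" by fastforce
    then have "a < b" "b < n"
      using nth_mem[OF i] unfolding set_complete_edges by (auto simp: increasing_pairs_def)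
    then have pc: "p a \<in> carrier_vec d" "p b \<in> carrier_vec d" using p by auto
    then have dim: "dim_vec (edge_dir d p a b) = d" by (simp add: edge_dir_def)
    have "?R $$ (u * d + j, i) = (unit_vec n a $ u - unit_vec n b $ u) * edge_dir d p a b $ j"
      using i k u j ab dim by (simp add: rigidity_matrix_def mat_of_cols_def kronecker_vec_def
          mult.commute)
    then show ?thesis
      using i ab \<open>a < b\<close> \<open>b < n\<close> u sym[of a b] edge_dir_swap[of p a d b j, OF pc j]
      by (auto simp: edge_vec_def g_def)
  qed
  have "(?R *\<^sub>v edge_vec n y) $ (u * d + j) = (\<Sum>i<length ?es. ?R $$ (u * d + j, i) * edge_vec n y $ i)"
    using k rigidity_matrix_carrier[of d n p]
    by (simp add: scalar_prod_def edge_vec_def atLeast0LessThan)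
  also have "\<dots> = (\<Sum>i<length ?es. case ?es ! i of (a, b) \<Rightarrow> g a b + g b a)"
    using entry by (intro sum.cong) auto
  also have "\<dots> = (\<Sum>(a, b)\<in>increasing_pairs n. g a b + g b a)"
    by (rule sum_complete_edges)
  also have "\<dots> = (\<Sum>a<n. \<Sum>b\<in>{..<n} - {a}. g a b)"
    by (rule sum_increasing_pairs)
  also have "\<dots> = (\<Sum>a<n. if a = u then (\<Sum>b\<in>{..<n} - {u}. y u b * edge_dir d p u b $ j) else 0)"
    by (intro sum.cong) (auto simp: g_def)
  finally show ?thesis using u by simp
qed

lemma rigidity_matrix_energy:
  assumes p: "\<And>v. v < n \<Longrightarrow> p v \<in> carrier_vec d" and sym: "\<And>u v. y u v = y v u"
  defines "z \<equiv> rigidity_matrix d (complete_graph n) p *\<^sub>v edge_vec n y"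
  shows "z \<bullet> z = (\<Sum>u<n. \<Sum>j<d. (\<Sum>v\<in>{..<n} - {u}. y u v * edge_dir d p u v $ j)\<^sup>2)"
proof -
  have "dim_vec z = n * d"
    unfolding z_def using rigidity_matrix_carrier[of d n p] by (simp add: mult.commute)
  then have "z \<bullet> z = (\<Sum>k<n * d. (z $ k)\<^sup>2)"
    by (simp add: scalar_prod_def atLeast0LessThan power2_eq_square)
  also have "\<dots> = (\<Sum>u<n. \<Sum>k\<in>{u * d..<u * d + d}. (z $ k)\<^sup>2)"
    by (rule sum.nat_group[symmetric])
  also have "\<dots> = (\<Sum>u<n. \<Sum>j<d. (z $ (u * d + j))\<^sup>2)"
    by (rule sum.cong[OF refl], rule trans[OF sum.atLeastLessThan_shift_0]) (simp add: atLeast0LessThan)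
  also have "\<dots> = (\<Sum>u<n. \<Sum>j<d. (\<Sum>v\<in>{..<n} - {u}. y u v * edge_dir d p u v $ j)\<^sup>2)"
    unfolding z_def by (intro sum.cong refl) (simp add: rigidity_matrix_mult_edge_vec[OF p sym])
  finally show ?thesis .
qed

section \<open>Lower bound from the regular simplex\<close>

definition sq_dist :: "nat \<Rightarrow> (nat \<Rightarrow> real vec) \<Rightarrow> nat \<Rightarrow> nat \<Rightarrow> real" where
  "sq_dist d p u v = (\<Sum>j<d. (p u $ j - p v $ j)\<^sup>2)"

lemma sq_dist_commute: "sq_dist d p u v = sq_dist d p v u"
  by (simp add: sq_dist_def power2_commute)

lemma eucl_norm_diff:
  assumes "p u \<in> carrier_vec d" "p v \<in> carrier_vec d"
  shows "eucl_norm (p u - p v) = sqrt (sq_dist d p u v)"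
  using assms by (simp add: eucl_norm_def scalar_prod_def sq_dist_def power2_eq_square atLeast0LessThan)

text \<open>For a regular simplex the Gram matrix of the edge columns is
  \<open>I + B\<^sup>t B / 2\<close> with \<open>B\<close> the vertex-edge incidence matrix.\<close>

lemma regular_simplex_energy_ge:
  assumes p: "\<And>v. v < n \<Longrightarrow> p v \<in> carrier_vec d"
    and reg: "\<And>u v. u < n \<Longrightarrow> v < n \<Longrightarrow> u \<noteq> v \<Longrightarrow> sq_dist d p u v = 2"
    and x: "x \<in> carrier_vec (length (complete_edges n))"
  defines "z \<equiv> rigidity_matrix d (complete_graph n) p *\<^sub>v x"
  shows "x \<bullet> x \<le> z \<bullet> z"
proof -
  obtain y where sym: "\<And>u v. y u v = y v u" and xy: "x = edge_vec n y"
    using edge_vec_exhaust[OF x] by blast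
  \<comment> \<open>The comparison is made vertex by vertex: summed over \<open>u\<close>, the left
    sides give \<open>x \<bullet> x\<close>, each edge being split evenly between its
    endpoints.\<close>
  have "(\<Sum>v\<in>{..<n} - {u}. (y u v)\<^sup>2) / 2 \<le>
      (\<Sum>j<d. (\<Sum>v\<in>{..<n} - {u}. y u v * edge_dir d p u v $ j)\<^sup>2)" if u: "u < n" for u
  proof -
    let ?V = "{..<n} - {u}"
    define D where "D v j = (p u $ j - p v $ j) / sqrt 2" for v j
    have dir: "edge_dir d p u v $ j = D v j" if "v \<in> ?V" "j < d" for v j
    proof -
      have "eucl_norm (p u - p v) = sqrt 2"
        using eucl_norm_diff[of p u d v] reg[of u v] p u that by auto
      then show ?thesis using that u p by (simp add: edge_dir_index D_def)
    qed
    \<comment> \<open>Polarisation expresses the inner product through the three squared distances,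
      all equal to 2 for distinct vertices: the edges at \<open>u\<close> meet at 60
      degrees.\<close>
    have gram: "(\<Sum>j<d. D v j * D w j) = (if v = w then 1 else 1 / 2)" if "v \<in> ?V" "w \<in> ?V" for v w
    proof -
      have "(\<Sum>j<d. D v j * D w j) = (\<Sum>j<d. ((p u $ j - p v $ j)\<^sup>2 + (p u $ j - p w $ j)\<^sup>2 - (p v $ j - p w $ j)\<^sup>2) / 4)"
        by (intro sum.cong refl) (simp add: D_def power2_eq_square field_simps)
      also have "\<dots> = (sq_dist d p u v + sq_dist d p u w - sq_dist d p v w) / 4"
        by (simp add: sq_dist_def sum.distrib sum_subtractf flip: sum_divide_distrib)
      also have "\<dots> = (if v = w then 1 else 1 / 2)"
        using reg that u by (auto simp: sq_dist_def)
      finally show ?thesis .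
    qed
    have "(\<Sum>j<d. (\<Sum>v\<in>?V. y u v * edge_dir d p u v $ j)\<^sup>2) = (\<Sum>j<d. (\<Sum>v\<in>?V. y u v * D v j)\<^sup>2)"
      using dir by (intro sum.cong arg_cong[of _ _ "\<lambda>t. t\<^sup>2"]) auto
    also have "\<dots> = (\<Sum>j<d. \<Sum>v\<in>?V. \<Sum>w\<in>?V. y u v * y u w * (D v j * D w j))"
      by (simp add: power2_eq_square sum_product mult_ac)
    also have "\<dots> = (\<Sum>v\<in>?V. \<Sum>j<d. \<Sum>w\<in>?V. y u v * y u w * (D v j * D w j))"
      by (rule sum.swap)
    also have "\<dots> = (\<Sum>v\<in>?V. \<Sum>w\<in>?V. \<Sum>j<d. y u v * y u w * (D v j * D w j))"
      by (rule sum.cong[OF refl sum.swap])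
    also have "\<dots> = (\<Sum>v\<in>?V. \<Sum>w\<in>?V. y u v * y u w * (\<Sum>j<d. D v j * D w j))"
      by (simp only: sum_distrib_left)
    also have "\<dots> = (\<Sum>v\<in>?V. \<Sum>w\<in>?V. y u v * y u w / 2 + (if v = w then (y u v)\<^sup>2 / 2 else 0))"
      by (intro sum.cong refl) (auto simp: gram power2_eq_square)
    also have "\<dots> = (\<Sum>v\<in>?V. y u v)\<^sup>2 / 2 + (\<Sum>v\<in>?V. (y u v)\<^sup>2) / 2"
      by (simp add: sum.distrib power2_eq_square sum_product sum_divide_distrib)
    \<comment> \<open>The squared weighted degree of \<open>u\<close> is nonnegative and is
      dropped.\<close>
    finally show ?thesis by simp
  qed
  then have "(\<Sum>u<n. (\<Sum>v\<in>{..<n} - {u}. (y u v)\<^sup>2) / 2) \<le>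
      (\<Sum>u<n. \<Sum>j<d. (\<Sum>v\<in>{..<n} - {u}. y u v * edge_dir d p u v $ j)\<^sup>2)"
    by (intro sum_mono) auto
  also have "\<dots> = z \<bullet> z"
    unfolding z_def xy by (rule rigidity_matrix_energy[OF p sym, symmetric])
  finally show ?thesis
    unfolding xy edge_vec_norm[of y n, OF sym] sum_divide_distrib .
qed

text \<open>The standard basis vectors are already pairwise at squared distance 2; one apex with all
  coordinates equal completes the simplex.\<close>

lemma regular_simplex_exists:
  assumes d: "d > 0"
  obtains p :: "nat \<Rightarrow> real vec" where "\<And>v. p v \<in> carrier_vec d"
    "\<And>u v. u \<le> d \<Longrightarrow> v \<le> d \<Longrightarrow> u \<noteq> v \<Longrightarrow> sq_dist d p u v = 2"
proof
  \<comment> \<open>The squared distance from the apex to a basis vector is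
    \<open>d * c\<^sup>2 - 2 * c + 1\<close>; \<open>c\<close> is the positive root that makes it
    2.\<close>
  define c where "c = (1 + sqrt (1 + real d)) / real d"
  define p where "p u = (if u < d then unit_vec d u else vec d (\<lambda>_. c))" for u :: nat
  show "p v \<in> carrier_vec d" for v by (simp add: p_def)
  have c: "(real d * c - 1)\<^sup>2 = 1 + real d" using d by (simp add: c_def)
  have "real d * (real d * c\<^sup>2 - 2 * c - 1) = 0"
    using c by (simp add: power2_eq_square algebra_simps)
  then have c': "real d * c\<^sup>2 - 2 * c = 1" using d by simp
  have apex: "sq_dist d p u d = 2" if u: "u < d" for u
  proof -
    have "sq_dist d p u d = (\<Sum>j<d. c\<^sup>2 + (if j = u then 1 - 2 * c else 0))"
      unfolding sq_dist_def using u by (intro sum.cong) (auto simp: p_def power2_eq_square algebra_simps)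
    also have "\<dots> = 2" using u c' by (simp add: sum.distrib)
    finally show ?thesis .
  qed
  have base: "sq_dist d p u v = 2" if "u < d" "v < d" "u \<noteq> v" for u v
  proof -
    have "sq_dist d p u v = (\<Sum>j<d. (if j = u then 1 else 0) + (if j = v then 1 else 0))"
      unfolding sq_dist_def using that by (intro sum.cong) (auto simp: p_def)
    also have "\<dots> = 2" using that by (simp add: sum.distrib)
    finally show ?thesis .
  qed
  show "sq_dist d p u v = 2" if "u \<le> d" "v \<le> d" "u \<noteq> v" for u v
    using that apex[of u] apex[of v] base[of u v] sq_dist_commute[of d p u v]
    by (cases "u = d"; cases "v = d") auto
qed

section \<open>Upper bound from alternating four-cycles\<close>

text \<open>Scaling the edge weights by the edge lengths cancels the normalisation of the directions; both
  sides vanish on edges of length 0.\<close>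

lemma edge_vec_scaled_energy:
  assumes p: "\<And>v. v < n \<Longrightarrow> p v \<in> carrier_vec d"
    and sym: "\<And>u v. s u v = s v u"
  defines "x \<equiv> edge_vec n (\<lambda>u v. s u v * sqrt (sq_dist d p u v))"
  defines "z \<equiv> rigidity_matrix d (complete_graph n) p *\<^sub>v x"
  shows "x \<bullet> x = (\<Sum>u<n. \<Sum>v\<in>{..<n} - {u}. (s u v)\<^sup>2 * sq_dist d p u v) / 2"
    and "z \<bullet> z = (\<Sum>u<n. \<Sum>j<d. (\<Sum>v\<in>{..<n} - {u}. s u v * (p u $ j - p v $ j))\<^sup>2)"
proof -
  let ?y = "\<lambda>u v. s u v * sqrt (sq_dist d p u v)"
  have sy: "?y u v = ?y v u" for u v using sym sq_dist_commute by metis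
  have nonneg: "sq_dist d p u v \<ge> 0" for u v by (simp add: sq_dist_def sum_nonneg)
  show "x \<bullet> x = (\<Sum>u<n. \<Sum>v\<in>{..<n} - {u}. (s u v)\<^sup>2 * sq_dist d p u v) / 2"
    unfolding x_def edge_vec_norm[of ?y n, OF sy] by (simp add: power_mult_distrib nonneg)
  have dir: "?y u v * edge_dir d p u v $ j = s u v * (p u $ j - p v $ j)"
    if "u < n" "v < n" "j < d" for u v j
  proof (cases "sq_dist d p u v = 0")
    case True
    then have "(p u $ j - p v $ j)\<^sup>2 = 0"
      using that unfolding sq_dist_def by (subst (asm) sum_nonneg_eq_0_iff) auto
    then show ?thesis using True by simp
  next
    case False
    then show ?thesis using that p by (simp add: edge_dir_index eucl_norm_diff[of p u d v])
  qed
  show "z \<bullet> z = (\<Sum>u<n. \<Sum>j<d. (\<Sum>v\<in>{..<n} - {u}. s u v * (p u $ j - p v $ j))\<^sup>2)"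
    unfolding z_def x_def
    by (rule trans[OF rigidity_matrix_energy[OF p sy]], assumption, rule sum.cong[OF refl],
        rule sum.cong[OF refl], rule arg_cong[of _ _ "\<lambda>t. t\<^sup>2"], rule sum.cong[OF refl], rule dir) auto
qed

text \<open>Alternating signs around the closed walk a, b, c, e, so that at every vertex of the
  cycle its two edges carry opposite signs.\<close>

definition four_cycle_signs :: "nat \<Rightarrow> nat \<Rightarrow> nat \<Rightarrow> nat \<Rightarrow> nat \<Rightarrow> nat \<Rightarrow> real" where
  "four_cycle_signs a b c e u v =
     (if {u, v} = {a, b} \<or> {u, v} = {c, e} then 1
      else if {u, v} = {b, c} \<or> {u, v} = {e, a} then -1 else 0)"

text \<open>At a vertex of the cycle the opposite signs cancel its own position and leave the
  difference of its two neighbours, a diagonal. Each diagonal arises at two vertices, hence the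
  factor 2.\<close>

lemma four_cycle_energy:
  assumes p: "\<And>v. v < n \<Longrightarrow> p v \<in> carrier_vec d"
    and n: "a < n" "b < n" "c < n" "e < n" and dist: "distinct [a, b, c, e]"
  defines "x \<equiv> edge_vec n (\<lambda>u v. four_cycle_signs a b c e u v * sqrt (sq_dist d p u v))"
  defines "z \<equiv> rigidity_matrix d (complete_graph n) p *\<^sub>v x"
  shows "x \<bullet> x = sq_dist d p a b + sq_dist d p b c + sq_dist d p c e + sq_dist d p e a"
    and "z \<bullet> z = 2 * (sq_dist d p a c + sq_dist d p b e)"
proof -
  let ?s = "four_cycle_signs a b c e" and ?V = "{a, b, c, e}"
  have sym: "?s u v = ?s v u" for u v
    by (simp add: four_cycle_signs_def insert_commute)
  have outside: "?s u v = 0" if "v \<notin> ?V \<or> u = v" for u v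
    using that dist by (auto simp: four_cycle_signs_def doubleton_eq_iff)
  have outside': "?s u v = 0" if "u \<notin> ?V" for u v
    using outside[of u v] sym[of u v] that outside[of u v] outside[of v u] by simp
  have vals: "?s a b = 1" "?s b a = 1" "?s c e = 1" "?s e c = 1" "?s b c = -1" "?s c b = -1"
    "?s e a = -1" "?s a e = -1" "?s a c = 0" "?s c a = 0" "?s b e = 0" "?s e b = 0"
    using dist by (auto simp: four_cycle_signs_def doubleton_eq_iff)
  \<comment> \<open>The summands vanish off the cycle and at \<open>v = u\<close>, so the index set
    may be exchanged for \<open>?V\<close> although one contains \<open>u\<close> and the other may
    not.\<close>
  have inner: "(\<Sum>v\<in>{..<n} - {u}. f v) = (\<Sum>v\<in>?V. f v)"
    if "\<And>v. v \<notin> ?V \<or> u = v \<Longrightarrow> f v = 0" for f :: "nat \<Rightarrow> real" and u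
    using that n by (intro sum.mono_neutral_cong) auto
  have outer: "(\<Sum>u<n. f u) = (\<Sum>u\<in>?V. f u)"
    if "\<And>u. u \<notin> ?V \<Longrightarrow> f u = 0" for f :: "nat \<Rightarrow> real"
    using that n by (intro sum.mono_neutral_right) auto
  have diag: "?s u u = 0" for u using outside by simp
  have distinct4: "a \<noteq> b" "a \<noteq> c" "a \<noteq> e" "b \<noteq> c" "b \<noteq> e" "c \<noteq> e" using dist by auto
  have V: "(\<Sum>v\<in>?V. f v) = f a + f b + f c + f e" for f :: "nat \<Rightarrow> real"
    using distinct4 by simp
  have "x \<bullet> x = (\<Sum>u<n. \<Sum>v\<in>{..<n} - {u}. (?s u v)\<^sup>2 * sq_dist d p u v) / 2"
    unfolding x_def by (rule edge_vec_scaled_energy(1)[of n p d ?s, OF p sym])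
  also have "(\<Sum>u<n. \<Sum>v\<in>{..<n} - {u}. (?s u v)\<^sup>2 * sq_dist d p u v) =
      (\<Sum>u<n. \<Sum>v\<in>?V. (?s u v)\<^sup>2 * sq_dist d p u v)"
    by (rule sum.cong[OF refl inner]) (drule outside, simp)
  also have "\<dots> = (\<Sum>u\<in>?V. \<Sum>v\<in>?V. (?s u v)\<^sup>2 * sq_dist d p u v)"
  proof (rule outer)
    fix u assume "u \<notin> ?V"
    then have "?s u v = 0" for v by (rule outside')
    then show "(\<Sum>v\<in>?V. (?s u v)\<^sup>2 * sq_dist d p u v) = 0" by simp
  qed
  also have "\<dots> / 2 = sq_dist d p a b + sq_dist d p b c + sq_dist d p c e + sq_dist d p e a"
    unfolding V vals diag using sq_dist_commute[of d p a b] sq_dist_commute[of d p b c]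
      sq_dist_commute[of d p c e] sq_dist_commute[of d p e a] by simp
  finally show "x \<bullet> x = sq_dist d p a b + sq_dist d p b c + sq_dist d p c e + sq_dist d p e a" .
  have "z \<bullet> z = (\<Sum>u<n. \<Sum>j<d. (\<Sum>v\<in>{..<n} - {u}. ?s u v * (p u $ j - p v $ j))\<^sup>2)"
    unfolding z_def x_def by (rule edge_vec_scaled_energy(2)[of n p d ?s, OF p sym])
  also have "\<dots> = (\<Sum>u<n. \<Sum>j<d. (\<Sum>v\<in>?V. ?s u v * (p u $ j - p v $ j))\<^sup>2)"
    by (intro sum.cong refl arg_cong[of _ _ "\<lambda>t. t\<^sup>2"] inner) (drule outside, simp)
  also have "\<dots> = (\<Sum>u\<in>?V. \<Sum>j<d. (\<Sum>v\<in>?V. ?s u v * (p u $ j - p v $ j))\<^sup>2)"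
  proof (rule outer)
    fix u assume "u \<notin> ?V"
    then have "?s u v = 0" for v by (rule outside')
    then show "(\<Sum>j<d. (\<Sum>v\<in>?V. ?s u v * (p u $ j - p v $ j))\<^sup>2) = 0" by simp
  qed
  also have "\<dots> = sq_dist d p e b + sq_dist d p a c + sq_dist d p b e + sq_dist d p c a"
    unfolding V vals diag sq_dist_def by simp
  finally show "z \<bullet> z = 2 * (sq_dist d p a c + sq_dist d p b e)"
    using sq_dist_commute[of d p e b] sq_dist_commute[of d p c a] by simp
qed

text \<open>Weights scaled by edge lengths could all vanish when points coincide, so placements that
  are not injective get a test vector of their own.\<close>

lemma edge_vec_energy_le:
  assumes p: "\<And>v. v < n \<Longrightarrow> p v \<in> carrier_vec d" and n: "n \<ge> 4"
  obtains x where "x \<in> carrier_vec (length (complete_edges n))" "x \<bullet> x > 0"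
    "(rigidity_matrix d (complete_graph n) p *\<^sub>v x) \<bullet> (rigidity_matrix d (complete_graph n) p *\<^sub>v x) \<le> x \<bullet> x"
proof (cases "inj_on p {..<n}")
  case False
  then obtain a b where ab: "a < n" "b < n" "a \<noteq> b" "p a = p b" by (auto simp: inj_on_def)
  \<comment> \<open>All weight sits on the edge between two coincident points: its direction is
    zero, hence so is the energy, while the weight vector is not.\<close>
  define y :: "nat \<Rightarrow> nat \<Rightarrow> real" where "y u v = (if {u, v} = {a, b} then 1 else 0)" for u v
  have sym: "y u v = y v u" for u v by (simp add: y_def insert_commute)
  have pos: "edge_vec n y \<bullet> edge_vec n y > 0"
  proof -
    have "0 < (y a b)\<^sup>2" by (simp add: y_def)
    also have "\<dots> \<le> (\<Sum>v\<in>{..<n} - {a}. (y a v)\<^sup>2)"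
      using ab by (intro member_le_sum) auto
    also have "\<dots> \<le> (\<Sum>u<n. \<Sum>v\<in>{..<n} - {u}. (y u v)\<^sup>2)"
      using ab by (intro member_le_sum[of a _ "\<lambda>u. \<Sum>v\<in>{..<n} - {u}. (y u v)\<^sup>2"] sum_nonneg) auto
    finally show ?thesis unfolding edge_vec_norm[of y n, OF sym] by simp
  qed
  have "y u v * edge_dir d p u v $ j = 0" if "j < d" for u v j
    using that ab by (auto simp: y_def edge_dir_def doubleton_eq_iff)
  then have "(\<Sum>v\<in>{..<n} - {u}. y u v * edge_dir d p u v $ j) = 0" if "j < d" for u j
    using that by (intro sum.neutral) blast
  then have "(rigidity_matrix d (complete_graph n) p *\<^sub>v edge_vec n y) \<bullet>
      (rigidity_matrix d (complete_graph n) p *\<^sub>v edge_vec n y) = 0"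
    by (subst rigidity_matrix_energy[OF p sym]) auto
  then show ?thesis using that[OF edge_vec_carrier pos] pos by simp
next
  case True
  let ?Q = "sq_dist d p"
  note witness = that
  have pos: "?Q u v > 0" if uv: "u < n" "v < n" "u \<noteq> v" for u v
  proof -
    have "p u \<noteq> p v" using True uv by (auto simp: inj_on_def)
    then obtain j where "j < d" "p u $ j \<noteq> p v $ j"
      using p[OF uv(1)] p[OF uv(2)] by (auto simp: vec_eq_iff)
    then show ?thesis unfolding sq_dist_def by (intro sum_pos2[of _ j]) auto
  qed
  have cycle: thesis
    if *: "a < n" "b < n" "c < n" "e < n" "distinct [a, b, c, e]"
      and le: "2 * (?Q a c + ?Q b e) \<le> ?Q a b + ?Q b c + ?Q c e + ?Q e a" for a b c e
  proof (rule witness[OF edge_vec_carrier])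
    let ?x = "edge_vec n (\<lambda>u v. four_cycle_signs a b c e u v * sqrt (?Q u v))"
    note energy = four_cycle_energy[of n p d, OF p *, simplified]
    show "?x \<bullet> ?x > 0"
      using energy(1) pos[of a b] pos[of b c] pos[of c e] pos[of e a] * by simp
    show "(rigidity_matrix d (complete_graph n) p *\<^sub>v ?x) \<bullet> (rigidity_matrix d (complete_graph n) p *\<^sub>v ?x)
        \<le> ?x \<bullet> ?x"
      using energy le by simp
  qed
  \<comment> \<open>The three four-cycles on the vertices 0, 1, 2, 3. Each of the six pairs is a
    diagonal of one cycle and a side of the other two, so both sides have the same total over the
    three cases and the three reverse strict inequalities cannot hold together.\<close>
  consider "2 * (?Q 0 2 + ?Q 1 3) \<le> ?Q 0 1 + ?Q 1 2 + ?Q 2 3 + ?Q 3 0"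
    | "2 * (?Q 0 3 + ?Q 1 2) \<le> ?Q 0 1 + ?Q 1 3 + ?Q 3 2 + ?Q 2 0"
    | "2 * (?Q 0 1 + ?Q 2 3) \<le> ?Q 0 2 + ?Q 2 1 + ?Q 1 3 + ?Q 3 0"
    using sq_dist_commute[of d p 3 0] sq_dist_commute[of d p 3 2]
      sq_dist_commute[of d p 2 0] sq_dist_commute[of d p 2 1]
    by (smt (verit))
  then show thesis
  proof cases
    case 1
    then show thesis by (intro cycle[of 0 1 2 3]) (use n in auto)
  next
    case 2
    then show thesis by (intro cycle[of 0 1 3 2]) (use n in auto)
  next
    case 3
    then show thesis by (intro cycle[of 0 2 1 3]) (use n in auto)
  qed
qed

section \<open>The supremum over all placements\<close>

theorem theorem1p2:
  fixes d :: nat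
  assumes "d \<ge> 3"
  shows "algebraic_connectivity d (complete_graph (d + 1)) = 1"
proof -
  let ?n = "d + 1" and ?k = "(d + 1) choose 2"
  let ?G = "complete_graph ?n"
  let ?S = "{nth_smallest_eigenvalue (?k + 1) (stiffness_matrix d ?G p) | p.
            \<forall>v < fst ?G. p v \<in> carrier_vec d}"
  \<comment> \<open>The number of rows is exactly twice the number \<open>?k\<close> of edges, so
    the Gram matrix has size \<open>?k\<close>, and index \<open>?k + 1\<close> is the first one
    behind the \<open>?k\<close> additional zeros.\<close>
  have "2 * ?k = d * ?n" by (simp add: choose_two)
  moreover have len: "length (complete_edges ?n) = ?k"
    using length_complete_edges[of ?n] by (simp add: choose_two)
  ultimately have R: "rigidity_matrix d ?G p \<in> carrier_mat (?k + ?k) ?k" for p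
    using rigidity_matrix_carrier[of d ?n p] by (simp add: mult_2)
  have upper: "nth_smallest_eigenvalue (?k + 1) (stiffness_matrix d ?G p) \<le> 1"
    if p: "\<And>v. v < ?n \<Longrightarrow> p v \<in> carrier_vec d" for p
  proof -
    obtain x where x: "x \<in> carrier_vec (length (complete_edges ?n))" "x \<bullet> x > 0"
      "(rigidity_matrix d ?G p *\<^sub>v x) \<bullet> (rigidity_matrix d ?G p *\<^sub>v x) \<le> x \<bullet> x"
      \<comment> \<open>The hypothesis \<open>d \<ge> 3\<close> provides the four vertices of a
        four-cycle.\<close>
      using edge_vec_energy_le[of ?n p d] p assms by auto
    then have "x \<noteq> 0\<^sub>v ?k" by auto
    then show ?thesis
      using nth_smallest_eigenvalue_gram_le[OF R, of x p 1] x len by (simp add: stiffness_matrix_def)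
  qed
  obtain p :: "nat \<Rightarrow> real vec" where p: "\<And>v. p v \<in> carrier_vec d"
    and reg: "\<And>u v. u \<le> d \<Longrightarrow> v \<le> d \<Longrightarrow> u \<noteq> v \<Longrightarrow> sq_dist d p u v = 2"
    using regular_simplex_exists[of d] assms by auto
  have "1 \<le> nth_smallest_eigenvalue (Suc ?k) (rigidity_matrix d ?G p * (rigidity_matrix d ?G p)\<^sup>T)"
  proof (rule nth_smallest_eigenvalue_gram_ge[OF R])
    show "?k > 0" using assms by (simp add: zero_less_binomial_iff)
    fix x :: "real vec" assume "x \<in> carrier_vec ?k"
    then show "1 * (x \<bullet> x) \<le> (rigidity_matrix d ?G p *\<^sub>v x) \<bullet> (rigidity_matrix d ?G p *\<^sub>v x)"
      using regular_simplex_energy_ge[of ?n p d x] p reg len by simp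
  qed
  then have "nth_smallest_eigenvalue (?k + 1) (stiffness_matrix d ?G p) = 1"
    using upper[of p] p by (simp add: stiffness_matrix_def)
  then have "1 \<in> ?S" using p by force
  then have "Sup ?S = 1"
    using upper by (intro cSup_eq_maximum) auto
  then show ?thesis by (simp add: algebraic_connectivity_def)
qed

end
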